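(* Let $c,d\in\mathbb{R}$ with $d\ge1$ and $(c,d)\neq(0,1)$. Put $K=\sqrt{\frac{c^2}{4}+d-1}$, $\alpha=\frac c2+K$, $\beta=\frac c2-K$. Among the self-similar solutions with rotation speed $c$ and expanding speed $d$, the smooth solution other than the logarithmic spirals, namely $$x_+(\theta)=e^{(\alpha+i)\theta}(i-\alpha)+e^{(\beta+i)\theta}(i-\beta),\qquad \theta\in\mathbb{R},$$ is, up to rotation and scaling, the unique complete, non-compact solution without singularity.
   Context: $\mathbb{R}^2$ is identified with $\mathbb{C}$ and $\langle z,w\rangle=\mathrm{Re}(z\bar w)$. A regular curve $x$ with unit tangent $T$, normal $N=iT$ and signed curvature $k=\langle dT/ds,N\rangle\neq0$ ($s$ arc length) evolves under the inverse mean curvature flow (normal velocity $-1/k$ with respect to $N$) by the self-similar motion $e^{(d-ci)t}x$ if and only if $c\langle x,T\rangle-d\langle x,N\rangle=\frac1k$. Here $c$ is called the rotation speed and $d$ the expanding speed. Self-similar solutions are continued through singular points where $1/k=0$. Parametrizing by the angle $\theta$ of the tangent ($T=\pm e^{i\theta}$), a self-similar solution with rotation speed $c$ and expanding speed $d$ is a not identically zero smooth map $x:\mathbb{R}\to\mathbb{C}$ with $$x'(\theta)=\rho(\theta)e^{i\theta},\qquad \rho(\theta)=c\langle x(\theta),e^{i\theta}\rangle-d\langle x(\theta),ie^{i\theta}\rangle .$$ Two solutions $x,y$ are the same up to rotation and scaling if there are $\lambda\in\mathbb{C}\setminus\{0\}$ and $\omega\in\mathbb{R}$ with $\lambda e^{-i\omega}\in\mathbb{R}$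 and $y(\theta)=\lambda x(\theta-\omega)$ for all $\theta$. A solution is without singularity (smooth) if $\rho$ never vanishes. It is complete if its length is infinite in both directions, i.e. $\int_0^\infty|\rho|\,d\theta=\int_{-\infty}^0|\rho|\,d\theta=\infty$, and non-compact if its image is not a compact (closed) curve. A logarithmic spiral is a curve $\theta\mapsto b\,e^{(a+i)\theta}$ with $a\in\mathbb{R}$, $b\in\mathbb{C}\setminus\{0\}$, where $a=0$ (a circle) is included. *)

theory Defs
  imports "HOL-Analysis.Analysis"
begin

text \<open>The inner product of \<^term>\<open>z :: complex\<close> and \<^term>\<open>w :: complex\<close>,
  viewed as vectors of the plane, is \<open>Re (z * cnj w)\<close>.\<close>

definition rho :: "real \<Rightarrow> real \<Rightarrow> (real \<Rightarrow> complex) \<Rightarrow> real \<Rightarrow> real" where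
  "rho c d x \<theta> = c * (x \<theta> \<bullet> cis \<theta>) - d * (x \<theta> \<bullet> (\<i> * cis \<theta>))"

text \<open>Being of class C-infinity: \<open>F n\<close> is the \<open>n\<close>-th derivative of \<open>f\<close>.\<close>

definition smooth_map :: "(real \<Rightarrow> complex) \<Rightarrow> bool" where
  "smooth_map f \<longleftrightarrow>
     (\<exists>F :: nat \<Rightarrow> real \<Rightarrow> complex. F 0 = f \<and>
        (\<forall>n t. (F n has_vector_derivative F (Suc n) t) (at t)))"

definition self_similar_solution :: "real \<Rightarrow> real \<Rightarrow> (real \<Rightarrow> complex) \<Rightarrow> bool" where
  "self_similar_solution c d x \<longleftrightarrow>
     smooth_map x \<and> (\<exists>\<theta>. x \<theta> \<noteq> 0) \<and>
     (\<forall>\<theta>. (x has_vector_derivative rho c d x \<theta> *\<^sub>R cis \<theta>) (at \<theta>))"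

text \<open>The condition on \<open>u * cis (- \<omega>)\<close> keeps \<open>\<theta>\<close> the tangent angle of \<open>y\<close>: a rotation of the
  curve has to be matched, modulo \<open>\<pi>\<close>, by the shift of the parameter.\<close>

definition same_up_to_rotation_scaling ::
    "(real \<Rightarrow> complex) \<Rightarrow> (real \<Rightarrow> complex) \<Rightarrow> bool" where
  "same_up_to_rotation_scaling x y \<longleftrightarrow>
     (\<exists>(u :: complex) (\<omega> :: real). u \<noteq> 0 \<and> u * cis (- \<omega>) \<in> \<real> \<and> (\<forall>\<theta>. y \<theta> = u * x (\<theta> - \<omega>)))"

definition without_singularity :: "real \<Rightarrow> real \<Rightarrow> (real \<Rightarrow> complex) \<Rightarrow> bool" where
  "without_singularity c d x \<longleftrightarrow> (\<forall>\<theta>. rho c d x \<theta> \<noteq> 0)"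

definition complete_solution :: "real \<Rightarrow> real \<Rightarrow> (real \<Rightarrow> complex) \<Rightarrow> bool" where
  "complete_solution c d x \<longleftrightarrow>
     (\<integral>\<^sup>+\<theta>\<in>{0..}. ennreal \<bar>rho c d x \<theta>\<bar> \<partial>lborel) = \<infinity> \<and>
     (\<integral>\<^sup>+\<theta>\<in>{..0}. ennreal \<bar>rho c d x \<theta>\<bar> \<partial>lborel) = \<infinity>"

definition noncompact_curve :: "(real \<Rightarrow> complex) \<Rightarrow> bool" where
  "noncompact_curve x \<longleftrightarrow> \<not> compact (range x)"

definition logarithmic_spiral :: "(real \<Rightarrow> complex) \<Rightarrow> bool" where
  "logarithmic_spiral x \<longleftrightarrow>
     (\<exists>(a :: real) (b :: complex). b \<noteq> 0 \<and>
        (\<forall>\<theta>. x \<theta> = b * exp ((complex_of_real a + \<i>) * complex_of_real \<theta>)))"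

end

theory Submission imports Defs begin

text \<open>
  In the moving frame \<open>x = cis \<theta> * (p + \<i> q)\<close> the equation of a self-similar solution is the
  linear system \<open>p' = c p + (1 - d) q\<close>, \<open>q' = - p\<close>. Its characteristic polynomial is
  \<open>\<lambda>\<^sup>2 - c \<lambda> + (1 - d)\<close>, whose roots are \<open>\<alpha>\<close> and \<open>\<beta>\<close>, so \<open>c = \<alpha> + \<beta>\<close> and \<open>d = 1 - \<alpha> \<beta>\<close>. Under the
  hypotheses on \<open>(c, d)\<close> the roots are real and distinct with \<open>\<beta> \<le> 0 \<le> \<alpha>\<close>. The speeds
  are therefore written in terms of the two roots below.

  Hence every solution has \<open>q = A exp (\<alpha> \<theta>) + B exp (\<beta> \<theta>)\<close>, and
  \<open>\<rho> = - (A (\<alpha>\<^sup>2 + 1) exp (\<alpha> \<theta>) + B (\<beta>\<^sup>2 + 1) exp (\<beta> \<theta>))\<close> (lemmas \<open>self_similar_is_mode_sum\<close> and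
  \<open>rho_mode_sum\<close>). Since the ratio of the two exponentials takes every positive value, \<open>\<rho>\<close> has a
  zero when \<open>A B < 0\<close>. When \<open>A B > 0\<close>, a shift of \<open>\<theta>\<close> and a real factor normalize both
  coefficients to \<open>1\<close>, which gives \<open>x\<^sub>+\<close>. When one coefficient vanishes the curve is a logarithmic
  spiral. This trichotomy (\<open>nonsingular_solution_cases\<close>) proves uniqueness among the solutions
  without singularity that are not logarithmic spirals.

  For the characterization by completeness, the solution \<open>x\<^sub>+\<close> has \<open>\<bar>\<rho>\<bar> \<ge> 1\<close> everywhere, thanks to
  the first mode for \<open>\<theta> \<ge> 0\<close> and to the second for \<open>\<theta> \<le> 0\<close>, and it is unbounded because
  one of the roots is not zero. A single mode, in contrast, has finite length at the end where it
  decays, unless its root is zero; but then it is a circle, which is compact.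
\<close>

section \<open>The exponential modes\<close>

text \<open>The solution whose normal component \<open>\<langle>x, \<i> cis \<theta>\<rangle>\<close> is \<open>A exp (\<alpha> \<theta>) + B exp (\<beta> \<theta>)\<close>; its
  tangential component is minus the derivative of that.\<close>

definition mode_sum :: "real \<Rightarrow> real \<Rightarrow> real \<Rightarrow> real \<Rightarrow> real \<Rightarrow> complex" where
  "mode_sum \<alpha> \<beta> A B \<theta> =
     cis \<theta> * Complex (- (A * \<alpha> * exp (\<alpha> * \<theta>) + B * \<beta> * exp (\<beta> * \<theta>)))
                     (A * exp (\<alpha> * \<theta>) + B * exp (\<beta> * \<theta>))"

lemma inner_cis_frame:
  "(cis \<theta> * Complex p q) \<bullet> cis \<theta> = p" "(cis \<theta> * Complex p q) \<bullet> (\<i> * cis \<theta>) = q"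
proof -
  have "(cos \<theta> * p - sin \<theta> * q) * cos \<theta> + (cos \<theta> * q + sin \<theta> * p) * sin \<theta> = p"
    using sin_cos_squared_add [of \<theta>] by algebra
  then show "(cis \<theta> * Complex p q) \<bullet> cis \<theta> = p" by (simp add: inner_complex_def)
  have "(cos \<theta> * q + sin \<theta> * p) * cos \<theta> - (cos \<theta> * p - sin \<theta> * q) * sin \<theta> = q"
    using sin_cos_squared_add [of \<theta>] by algebra
  then show "(cis \<theta> * Complex p q) \<bullet> (\<i> * cis \<theta>) = q" by (simp add: inner_complex_def)
qed

lemma rho_mode_sum:
  "rho (\<alpha> + \<beta>) (1 - \<alpha> * \<beta>) (mode_sum \<alpha> \<beta> A B) \<theta> =
     - (A * (\<alpha>\<^sup>2 + 1) * exp (\<alpha> * \<theta>) + B * (\<beta>\<^sup>2 + 1) * exp (\<beta> * \<theta>))"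
  unfolding rho_def mode_sum_def inner_cis_frame
  by (simp add: algebra_simps power2_eq_square)

lemma exp_shift_cis:
  "exp ((complex_of_real a + \<i>) * complex_of_real \<theta>) = cis \<theta> * complex_of_real (exp (a * \<theta>))"
proof -
  have "(complex_of_real a + \<i>) * complex_of_real \<theta> = \<i> * complex_of_real \<theta> + complex_of_real (a * \<theta>)"
    by (simp add: algebra_simps)
  then show ?thesis by (simp only: exp_add cis_conv_exp exp_of_real)
qed

lemma mode_sum_exp:
  "mode_sum \<alpha> \<beta> A B \<theta> =
     exp ((complex_of_real \<alpha> + \<i>) * complex_of_real \<theta>) * (complex_of_real A * (\<i> - complex_of_real \<alpha>)) +
     exp ((complex_of_real \<beta> + \<i>) * complex_of_real \<theta>) * (complex_of_real B * (\<i> - complex_of_real \<beta>))"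
  unfolding exp_shift_cis mode_sum_def by (simp add: complex_eq_iff algebra_simps)

text \<open>The powers of \<open>w\<close> make the right-hand side the same function with \<open>n\<close> replaced by \<open>Suc n\<close>,
  so that one statement yields the derivatives of every order.\<close>

lemma exp_linear_has_vector_derivative:
  fixes w v :: complex
  shows "((\<lambda>\<theta>. w ^ n * exp (w * complex_of_real \<theta>) * v) has_vector_derivative
           w ^ Suc n * exp (w * complex_of_real \<theta>) * v) (at \<theta>)"
proof -
  have "((\<lambda>z. w ^ n * exp (w * z) * v) has_field_derivative
          w ^ Suc n * exp (w * complex_of_real \<theta>) * v) (at (complex_of_real \<theta>))"
    by (auto intro!: derivative_eq_intros)
  from has_vector_derivative_real_field [OF this] show ?thesis
    by (simp add: o_def)
qed

lemma smooth_mode_sum: "smooth_map (mode_sum \<alpha> \<beta> A B)"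
  unfolding smooth_map_def
proof (intro exI conjI allI)
  define w where "w a = complex_of_real a + \<i>" for a
  define v where "v a C = complex_of_real C * (\<i> - complex_of_real a)" for a C
  let ?F = "\<lambda>n \<theta>. w \<alpha> ^ n * exp (w \<alpha> * complex_of_real \<theta>) * v \<alpha> A
                 + w \<beta> ^ n * exp (w \<beta> * complex_of_real \<theta>) * v \<beta> B"
  show "?F 0 = mode_sum \<alpha> \<beta> A B"
    by (simp add: fun_eq_iff mode_sum_exp w_def v_def)
  show "(?F n has_vector_derivative ?F (Suc n) t) (at t)" for n t
    by (intro has_vector_derivative_add exp_linear_has_vector_derivative)
qed

lemma self_similar_mode_sum:
  assumes "\<alpha> \<noteq> \<beta>" "A \<noteq> 0 \<or> B \<noteq> 0"
  shows "self_similar_solution (\<alpha> + \<beta>) (1 - \<alpha> * \<beta>) (mode_sum \<alpha> \<beta> A B)"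
  unfolding self_similar_solution_def
proof (intro conjI allI)
  show "\<exists>\<theta>. mode_sum \<alpha> \<beta> A B \<theta> \<noteq> 0"
  proof (rule exI [of _ 0], rule notI)
    assume "mode_sum \<alpha> \<beta> A B 0 = 0"
    then have "A * \<alpha> + B * \<beta> = 0" "A + B = 0"
      by (auto simp: mode_sum_def complex_eq_iff)
    then have "A * (\<alpha> - \<beta>) = 0" "B = - A" by algebra+
    with assms show False by simp
  qed
  fix \<theta>
  define w where "w a = complex_of_real a + \<i>" for a
  define v where "v a C = complex_of_real C * (\<i> - complex_of_real a)" for a C
  have "(mode_sum \<alpha> \<beta> A B has_vector_derivative
          w \<alpha> * exp (w \<alpha> * \<theta>) * v \<alpha> A + w \<beta> * exp (w \<beta> * \<theta>) * v \<beta> B) (at \<theta>)"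
    using has_vector_derivative_add
      [OF exp_linear_has_vector_derivative [of "w \<alpha>" 0 "v \<alpha> A" \<theta>]
          exp_linear_has_vector_derivative [of "w \<beta>" 0 "v \<beta> B" \<theta>]]
    by (simp add: mode_sum_exp [abs_def] w_def v_def)
  moreover have "w \<alpha> * exp (w \<alpha> * \<theta>) * v \<alpha> A + w \<beta> * exp (w \<beta> * \<theta>) * v \<beta> B =
      rho (\<alpha> + \<beta>) (1 - \<alpha> * \<beta>) (mode_sum \<alpha> \<beta> A B) \<theta> *\<^sub>R cis \<theta>"
    unfolding rho_mode_sum w_def v_def exp_shift_cis
    by (simp add: complex_eq_iff algebra_simps power2_eq_square)
  ultimately show "(mode_sum \<alpha> \<beta> A B has_vector_derivative
      rho (\<alpha> + \<beta>) (1 - \<alpha> * \<beta>) (mode_sum \<alpha> \<beta> A B) \<theta> *\<^sub>R cis \<theta>) (at \<theta>)" by simp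
qed (rule smooth_mode_sum)

section \<open>Every solution is a sum of two modes\<close>

lemma linear_ode_exp:
  fixes a :: "real \<Rightarrow> real"
  assumes "\<And>t. (a has_real_derivative r * a t) (at t)"
  shows "a t = a 0 * exp (r * t)"
proof -
  have "((\<lambda>t. a t * exp (- r * t)) has_real_derivative 0) (at t)" for t
    by (auto intro!: derivative_eq_intros assms)
  from DERIV_isconst_all [of "\<lambda>t. a t * exp (- r * t)" t 0] this
  have "a t * exp (- r * t) = a 0" by simp
  then show ?thesis by (simp add: exp_minus field_simps)
qed

text \<open>The combinations \<open>p + \<beta> q\<close> and \<open>p + \<alpha> q\<close> diagonalize the system for the frame components: they
  satisfy \<open>a' = \<alpha> a\<close> and \<open>b' = \<beta> b\<close> and so are pure exponentials. Because the roots differ,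
  \<open>p\<close> and \<open>q\<close> can be recovered from them.\<close>

lemma self_similar_is_mode_sum:
  assumes "self_similar_solution (\<alpha> + \<beta>) (1 - \<alpha> * \<beta>) x" "\<alpha> \<noteq> \<beta>"
  obtains A B where "A \<noteq> 0 \<or> B \<noteq> 0" "x = mode_sum \<alpha> \<beta> A B"
proof -
  define X Y where "X t = Re (x t)" and "Y t = Im (x t)" for t
  define p where "p t = X t * cos t + Y t * sin t" for t
  define q where "q t = Y t * cos t - X t * sin t" for t
  let ?r = "rho (\<alpha> + \<beta>) (1 - \<alpha> * \<beta>) x"
  have r: "?r t = (\<alpha> + \<beta>) * p t - (1 - \<alpha> * \<beta>) * q t" for t
    by (simp add: rho_def p_def q_def X_def Y_def inner_complex_def)
  have x: "x t = cis t * Complex (p t) (q t)" for t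
  proof -
    have "X t = cos t * p t - sin t * q t" "Y t = cos t * q t + sin t * p t"
      unfolding p_def q_def using sin_cos_squared_add [of t] by algebra+
    then show ?thesis by (simp add: complex_eq_iff X_def Y_def)
  qed
  have dx: "(x has_vector_derivative ?r t *\<^sub>R cis t) (at t)" for t
    using assms(1) by (simp add: self_similar_solution_def)
  have dX: "(X has_real_derivative ?r t * cos t) (at t)"
   and dY: "(Y has_real_derivative ?r t * sin t) (at t)" for t
    using bounded_linear.has_vector_derivative [OF bounded_linear_Re dx [of t]]
      bounded_linear.has_vector_derivative [OF bounded_linear_Im dx [of t]]
    by (simp_all add: has_real_derivative_iff_has_vector_derivative X_def [abs_def] Y_def [abs_def])
  have dp: "(p has_real_derivative (\<alpha> + \<beta>) * p t + \<alpha> * \<beta> * q t) (at t)" for t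
  proof -
    have "(p has_real_derivative
        ?r t * cos t * cos t - X t * sin t + (?r t * sin t * sin t + Y t * cos t)) (at t)"
      unfolding p_def [abs_def] by (auto intro!: derivative_eq_intros dX dY)
    moreover have "?r t * cos t * cos t - X t * sin t + (?r t * sin t * sin t + Y t * cos t) = ?r t + q t"
      unfolding q_def using sin_cos_squared_add [of t] by algebra
    ultimately show ?thesis by (simp add: r algebra_simps)
  qed
  have dq: "(q has_real_derivative - p t) (at t)" for t
    unfolding q_def [abs_def] p_def
    by (auto intro!: derivative_eq_intros dX dY simp: algebra_simps)
  have a: "p t + \<beta> * q t = (p 0 + \<beta> * q 0) * exp (\<alpha> * t)" for t
    by (rule linear_ode_exp [of "\<lambda>t. p t + \<beta> * q t"])
      (auto intro!: derivative_eq_intros dp dq simp: algebra_simps)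
  have b: "p t + \<alpha> * q t = (p 0 + \<alpha> * q 0) * exp (\<beta> * t)" for t
    by (rule linear_ode_exp [of "\<lambda>t. p t + \<alpha> * q t"])
      (auto intro!: derivative_eq_intros dp dq simp: algebra_simps)
  define A where "A = (p 0 + \<beta> * q 0) / (\<beta> - \<alpha>)"
  define B where "B = (p 0 + \<alpha> * q 0) / (\<alpha> - \<beta>)"
  have A: "p t + \<beta> * q t = (\<beta> - \<alpha>) * A * exp (\<alpha> * t)" for t
    using assms(2) by (subst a) (simp add: A_def)
  have B: "p t + \<alpha> * q t = (\<alpha> - \<beta>) * B * exp (\<beta> * t)" for t
    using assms(2) by (subst b) (simp add: B_def)
  have "(\<alpha> - \<beta>) * q t = (\<alpha> - \<beta>) * (A * exp (\<alpha> * t) + B * exp (\<beta> * t))" for t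
    using A [of t] B [of t] by (simp add: algebra_simps)
  then have q: "q t = A * exp (\<alpha> * t) + B * exp (\<beta> * t)" for t
    using assms(2) by simp
  have "p t = - (A * \<alpha> * exp (\<alpha> * t) + B * \<beta> * exp (\<beta> * t))" for t
    using A [of t] by (simp add: q algebra_simps)
  with q x have "x = mode_sum \<alpha> \<beta> A B"
    by (simp add: fun_eq_iff mode_sum_def)
  moreover have "A \<noteq> 0 \<or> B \<noteq> 0"
    using assms(1) calculation
    by (auto simp: self_similar_solution_def mode_sum_def complex_eq_iff)
  ultimately show ?thesis using that by blast
qed

section \<open>Solutions without singularity\<close>

lemma balanced_mode_sum_nonsingular:
  "without_singularity (\<alpha> + \<beta>) (1 - \<alpha> * \<beta>) (mode_sum \<alpha> \<beta> 1 1)"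
proof -
  have "(\<alpha>\<^sup>2 + 1) * exp (\<alpha> * \<theta>) + (\<beta>\<^sup>2 + 1) * exp (\<beta> * \<theta>) > 0" for \<theta>
    by (intro add_pos_pos mult_pos_pos add_nonneg_pos) auto
  then show ?thesis
    unfolding without_singularity_def rho_mode_sum by (metis less_irrefl mult_1 neg_equal_0_iff_equal)
qed

text \<open>If \<open>A\<close> and \<open>B\<close> have opposite signs, the quotient \<open>exp ((\<alpha> - \<beta>) \<theta>)\<close> of the two exponentials
  takes the positive value at which the two terms of \<open>\<rho>\<close> cancel.\<close>

lemma nonsingular_mode_sum_same_sign:
  assumes "without_singularity (\<alpha> + \<beta>) (1 - \<alpha> * \<beta>) (mode_sum \<alpha> \<beta> A B)" "\<alpha> \<noteq> \<beta>"
  shows "A * B \<ge> 0"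
proof (rule ccontr)
  assume neg: "\<not> A * B \<ge> 0"
  have pos: "\<alpha>\<^sup>2 + 1 > 0" "\<beta>\<^sup>2 + 1 > 0" by (auto intro: add_nonneg_pos)
  define s where "s = - (B * (\<beta>\<^sup>2 + 1)) / (A * (\<alpha>\<^sup>2 + 1))"
  define \<theta> where "\<theta> = ln s / (\<alpha> - \<beta>)"
  have "A \<noteq> 0" using neg by auto
  have "- (B / A) > 0"
    using neg by (auto simp: not_le mult_less_0_iff divide_less_0_iff)
  then have "s > 0"
    using mult_pos_pos [of "- (B / A)" "(\<beta>\<^sup>2 + 1) / (\<alpha>\<^sup>2 + 1)"] pos by (simp add: s_def)
  then have "exp ((\<alpha> - \<beta>) * \<theta>) = s"
    using assms(2) by (simp add: \<theta>_def)
  then have "exp (\<alpha> * \<theta>) = s * exp (\<beta> * \<theta>)"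
    by (simp add: left_diff_distrib exp_diff field_simps)
  then have "rho (\<alpha> + \<beta>) (1 - \<alpha> * \<beta>) (mode_sum \<alpha> \<beta> A B) \<theta> = 
      - (A * (\<alpha>\<^sup>2 + 1) * s + B * (\<beta>\<^sup>2 + 1)) * exp (\<beta> * \<theta>)"
    by (simp add: rho_mode_sum algebra_simps)
  also have "A * (\<alpha>\<^sup>2 + 1) * s + B * (\<beta>\<^sup>2 + 1) = 0"
    using \<open>A \<noteq> 0\<close> pos by (simp add: s_def)
  finally show False using assms(1) by (simp add: without_singularity_def)
qed

text \<open>Shifting the parameter by \<open>\<omega>\<close> multiplies the coefficients by \<open>exp (- \<alpha> \<omega>)\<close> and
  \<open>exp (- \<beta> \<omega>)\<close>, so as \<open>\<alpha> \<noteq> \<beta>\<close> their ratio can be made any positive number; a real factor \<open>r\<close>, negative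
  when \<open>A\<close> and \<open>B\<close> are, then adjusts their common size.\<close>

lemma mode_sum_same_up_to:
  assumes "A * B > 0" "\<alpha> \<noteq> \<beta>"
  shows "same_up_to_rotation_scaling (mode_sum \<alpha> \<beta> 1 1) (mode_sum \<alpha> \<beta> A B)"
proof -
  have AB: "A \<noteq> 0" "B / A > 0"
    using assms(1) by (auto simp: zero_less_mult_iff zero_less_divide_iff)
  define \<omega> where "\<omega> = ln (B / A) / (\<alpha> - \<beta>)"
  define r where "r = A * exp (\<alpha> * \<omega>)"
  have "exp ((\<alpha> - \<beta>) * \<omega>) = B / A"
    using AB assms(2) by (simp add: \<omega>_def)
  then have e: "A * exp (\<alpha> * \<omega>) = B * exp (\<beta> * \<omega>)"
    using AB by (simp add: left_diff_distrib exp_diff field_simps)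
  have A: "r * exp (\<alpha> * (\<theta> - \<omega>)) = A * exp (\<alpha> * \<theta>)"
    and B: "r * exp (\<beta> * (\<theta> - \<omega>)) = B * exp (\<beta> * \<theta>)" for \<theta>
    by (simp_all add: r_def right_diff_distrib exp_diff) (simp add: e)
  have "mode_sum \<alpha> \<beta> A B \<theta> = (of_real r * cis \<omega>) * mode_sum \<alpha> \<beta> 1 1 (\<theta> - \<omega>)" for \<theta>
  proof -
    have "(of_real r * cis \<omega>) * mode_sum \<alpha> \<beta> 1 1 (\<theta> - \<omega>) = (cis \<omega> * cis (\<theta> - \<omega>)) *
      Complex (- (\<alpha> * (r * exp (\<alpha> * (\<theta> - \<omega>))) + \<beta> * (r * exp (\<beta> * (\<theta> - \<omega>)))))
              (r * exp (\<alpha> * (\<theta> - \<omega>)) + r * exp (\<beta> * (\<theta> - \<omega>)))"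
      unfolding mode_sum_def by (simp add: complex_eq_iff algebra_simps)
    also have "\<dots> = mode_sum \<alpha> \<beta> A B \<theta>"
      unfolding A B cis_mult by (simp add: mode_sum_def mult_ac)
    finally show ?thesis by simp
  qed
  moreover have "of_real r * cis \<omega> \<noteq> 0" using AB by (simp add: r_def)
  moreover have "of_real r * cis \<omega> * cis (- \<omega>) \<in> \<real>" by (simp add: mult.assoc cis_mult)
  ultimately show ?thesis unfolding same_up_to_rotation_scaling_def by blast
qed

lemma mode_sum_commute: "mode_sum \<alpha> \<beta> A B = mode_sum \<beta> \<alpha> B A"
  by (simp add: fun_eq_iff mode_sum_def add.commute)

lemma single_mode_logarithmic_spiral:
  assumes "A \<noteq> 0"
  shows "logarithmic_spiral (mode_sum \<alpha> \<beta> A 0)"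
  unfolding logarithmic_spiral_def
proof (intro exI conjI allI)
  show "complex_of_real A * (\<i> - complex_of_real \<alpha>) \<noteq> 0"
    using assms by (auto simp: complex_eq_iff)
  show "mode_sum \<alpha> \<beta> A 0 \<theta> = complex_of_real A * (\<i> - complex_of_real \<alpha>) *
      exp ((complex_of_real \<alpha> + \<i>) * complex_of_real \<theta>)" for \<theta>
    by (simp add: mode_sum_exp)
qed

text \<open>The normal component of a spiral is a single exponential \<open>C exp (a \<theta>)\<close>, whose values at \<open>1\<close> and
  \<open>-1\<close> have as product the square of the value at \<open>0\<close>. For a sum of two exponentials with equal
  coefficients this forces the exponents to agree.\<close>

lemma balanced_mode_sum_not_spiral:
  assumes "\<alpha> \<noteq> \<beta>"
  shows "\<not> logarithmic_spiral (mode_sum \<alpha> \<beta> 1 1)"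
proof
  assume "logarithmic_spiral (mode_sum \<alpha> \<beta> 1 1)"
  then obtain a b where spiral: "\<And>\<theta>. mode_sum \<alpha> \<beta> 1 1 \<theta> =
      b * exp ((complex_of_real a + \<i>) * complex_of_real \<theta>)"
    unfolding logarithmic_spiral_def by blast
  have "exp (\<alpha> * \<theta>) + exp (\<beta> * \<theta>) = Im b * exp (a * \<theta>)" for \<theta>
  proof -
    have "cis \<theta> * Complex (- (\<alpha> * exp (\<alpha> * \<theta>) + \<beta> * exp (\<beta> * \<theta>))) (exp (\<alpha> * \<theta>) + exp (\<beta> * \<theta>))
        = cis \<theta> * (b * complex_of_real (exp (a * \<theta>)))"
      using spiral [of \<theta>] unfolding exp_shift_cis mode_sum_def by (simp only: mult_ac mult_1)
    then have "Complex (- (\<alpha> * exp (\<alpha> * \<theta>) + \<beta> * exp (\<beta> * \<theta>))) (exp (\<alpha> * \<theta>) + exp (\<beta> * \<theta>))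
        = b * complex_of_real (exp (a * \<theta>))"
      by simp
    from arg_cong [OF this, of Im] show ?thesis by simp
  qed
  from this [of 0] this [of 1] this [of "-1"]
  have b: "Im b = 2" and e: "exp \<alpha> + exp \<beta> = 2 * exp a"
    "exp (-\<alpha>) + exp (-\<beta>) = 2 * exp (-a)" by simp_all
  have "(exp \<alpha> + exp \<beta>) * (exp (-\<alpha>) + exp (-\<beta>)) = 4"
    unfolding e by (simp add: exp_minus)
  then have "(exp \<alpha> - exp \<beta>)\<^sup>2 = 0"
    by (simp add: exp_minus field_simps power2_eq_square)
  then show False using assms by simp
qed

section \<open>Completeness and compactness\<close>

lemma nn_integral_atMost_reflect:
  fixes f :: "real \<Rightarrow> ennreal"
  assumes [measurable]: "f \<in> borel_measurable borel"
  shows "(\<integral>\<^sup>+t\<in>{..0}. f t \<partial>lborel) = (\<integral>\<^sup>+t\<in>{0..}. f (- t) \<partial>lborel)"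
proof -
  have "(\<integral>\<^sup>+t\<in>{..0}. f t \<partial>lborel) = (\<integral>\<^sup>+t. f (- t) * indicator {..0} (- t) \<partial>lborel)"
    by (subst nn_integral_real_affine [where c = "-1" and t = 0]) auto
  also have "\<dots> = (\<integral>\<^sup>+t\<in>{0..}. f (- t) \<partial>lborel)"
    by (intro nn_integral_cong) (auto simp: indicator_def)
  finally show ?thesis .
qed

lemma nn_integral_infinite_if_bounded_below:
  fixes f :: "real \<Rightarrow> real"
  assumes "m > 0" "\<And>t. t \<ge> 0 \<Longrightarrow> f t \<ge> m"
  shows "(\<integral>\<^sup>+t\<in>{0..}. ennreal (f t) \<partial>lborel) = \<infinity>"
proof -
  have "ennreal m * of_nat n \<le> (\<integral>\<^sup>+t\<in>{0..}. ennreal (f t) \<partial>lborel)" for n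
  proof -
    have "ennreal m * of_nat n = (\<integral>\<^sup>+t\<in>{0..real n}. ennreal m \<partial>lborel)"
      by (simp add: nn_integral_cmult_indicator ennreal_of_nat_eq_real_of_nat)
    also have "\<dots> \<le> (\<integral>\<^sup>+t\<in>{0..}. ennreal (f t) \<partial>lborel)"
      using assms(2) by (intro nn_integral_mono) (auto simp: indicator_def ennreal_leI)
    finally show ?thesis .
  qed
  then have "(SUP n. ennreal m * of_nat n) \<le> (\<integral>\<^sup>+t\<in>{0..}. ennreal (f t) \<partial>lborel)"
    by (intro SUP_least)
  moreover have "(SUP n. ennreal m * of_nat n) = \<infinity>"
    using assms(1) by (simp add: SUP_mult_left_ennreal [symmetric] ennreal_SUP_of_nat_eq_top ennreal_mult_top)
  ultimately show ?thesis by (simp add: top_unique)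
qed

lemma nn_integral_exp_decay_finite:
  assumes "C \<ge> 0" "r < 0"
  shows "(\<integral>\<^sup>+t\<in>{0..}. ennreal (C * exp (r * t)) \<partial>lborel) < \<infinity>"
proof -
  have "((\<lambda>t. C / r * exp (r * t)) \<longlongrightarrow> C / r * 0) at_top"
    using assms(2) by (intro tendsto_mult tendsto_const filterlim_compose [OF exp_at_bot]
        filterlim_tendsto_neg_mult_at_bot [OF tendsto_const _ filterlim_ident])
  then have "(\<integral>\<^sup>+t. ennreal (C * exp (r * t)) * indicator {0..} t \<partial>lborel)
      = ennreal (0 - C / r * exp (r * 0))"
    using assms by (intro nn_integral_FTC_atLeast) (auto intro!: derivative_eq_intros)
  then show ?thesis by simp
qed

lemma rho_mode_sum_measurable:
  "(\<lambda>\<theta>. ennreal \<bar>rho (\<alpha> + \<beta>) (1 - \<alpha> * \<beta>) (mode_sum \<alpha> \<beta> A B) \<theta>\<bar>) \<in> borel_measurable borel"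
  unfolding rho_mode_sum by measurable

lemma balanced_mode_sum_complete:
  assumes "\<beta> \<le> 0" "0 \<le> \<alpha>"
  shows "complete_solution (\<alpha> + \<beta>) (1 - \<alpha> * \<beta>) (mode_sum \<alpha> \<beta> 1 1)"
proof -
  define g where "g a t = (a\<^sup>2 + 1) * exp (a * t)" for a t :: real
  have pos: "g a t > 0" for a t
    unfolding g_def by (intro mult_pos_pos add_nonneg_pos) auto
  \<comment> \<open>As \<open>a\<^sup>2 + 1 \<ge> 1\<close>, a mode contributes at least \<open>1\<close> to the speed where it does not decay: \<open>\<alpha>\<close> in
    the future, \<open>\<beta>\<close> in the past. A zero root, giving a constant mode, is included.\<close>
  have one_le: "1 \<le> g a t" if "a * t \<ge> 0" for a t
    unfolding g_def using mult_mono [of 1 "a\<^sup>2 + 1" 1 "exp (a * t)"] that by simp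
  have speed: "\<bar>rho (\<alpha> + \<beta>) (1 - \<alpha> * \<beta>) (mode_sum \<alpha> \<beta> 1 1) t\<bar> = g \<alpha> t + g \<beta> t" for t
    using pos [of \<alpha> t] pos [of \<beta> t] by (simp add: rho_mode_sum g_def)
  have "1 \<le> g \<alpha> t + g \<beta> t" if "t \<ge> 0" for t
    using one_le [of \<alpha> t] pos [of \<beta> t] assms that by simp
  then have future: "(\<integral>\<^sup>+t\<in>{0..}. ennreal (g \<alpha> t + g \<beta> t) \<partial>lborel) = \<infinity>"
    by (rule nn_integral_infinite_if_bounded_below [OF zero_less_one])
  have "1 \<le> g \<alpha> (- t) + g \<beta> (- t)" if "t \<ge> 0" for t
    using one_le [of \<beta> "- t"] pos [of \<alpha> "- t"] assms that by (simp add: mult_nonpos_nonneg)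
  then have "(\<integral>\<^sup>+t\<in>{0..}. ennreal (g \<alpha> (- t) + g \<beta> (- t)) \<partial>lborel) = \<infinity>"
    by (rule nn_integral_infinite_if_bounded_below [OF zero_less_one])
  moreover have "(\<lambda>t. ennreal (g \<alpha> t + g \<beta> t)) \<in> borel_measurable borel"
    unfolding g_def by measurable
  ultimately have past: "(\<integral>\<^sup>+t\<in>{..0}. ennreal (g \<alpha> t + g \<beta> t) \<partial>lborel) = \<infinity>"
    using nn_integral_atMost_reflect by simp
  show ?thesis
    unfolding complete_solution_def speed using future past by blast
qed

lemma balanced_mode_sum_noncompact:
  assumes "\<alpha> \<noteq> \<beta>"
  shows "noncompact_curve (mode_sum \<alpha> \<beta> 1 1)"
  unfolding noncompact_curve_def
proof
  assume "compact (range (mode_sum \<alpha> \<beta> 1 1))"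
  then have "bounded (range (mode_sum \<alpha> \<beta> 1 1))"
    by (rule compact_imp_bounded)
  then obtain M where M: "\<And>\<theta>. norm (mode_sum \<alpha> \<beta> 1 1 \<theta>) \<le> M"
    unfolding bounded_iff by blast
  have le: "exp (\<alpha> * \<theta>) + exp (\<beta> * \<theta>) \<le> M" for \<theta>
  proof -
    have "exp (\<alpha> * \<theta>) + exp (\<beta> * \<theta>) \<le> norm (mode_sum \<alpha> \<beta> 1 1 \<theta>)"
      using order_trans [OF abs_ge_self abs_Im_le_cmod,
          of "Complex (- (1 * \<alpha> * exp (\<alpha> * \<theta>) + 1 * \<beta> * exp (\<beta> * \<theta>)))
              (1 * exp (\<alpha> * \<theta>) + 1 * exp (\<beta> * \<theta>))"]
      unfolding mode_sum_def norm_mult norm_cis by (simp del: complex_norm)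
    also have "\<dots> \<le> M" by (rule M)
    finally show ?thesis .
  qed
  obtain \<gamma> where \<gamma>: "\<gamma> = \<alpha> \<or> \<gamma> = \<beta>" "\<gamma> \<noteq> 0"
    using assms by (cases "\<alpha> = 0") auto
  \<comment> \<open>Evaluating at \<open>M / \<gamma>\<close> bounds \<open>exp M\<close> by \<open>M\<close>, against \<open>1 + M \<le> exp M\<close>.\<close>
  have "exp (\<gamma> * \<theta>) \<le> M" for \<theta>
    using \<gamma>(1) le [of \<theta>] exp_gt_zero [of "\<alpha> * \<theta>"] exp_gt_zero [of "\<beta> * \<theta>"]
    by (elim disjE; hypsubst) linarith+
  from this [of "M / \<gamma>"] have "exp (\<gamma> * (M / \<gamma>)) \<le> M" .
  then show False using \<gamma>(2) exp_ge_add_one_self [of M] by simp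
qed

lemma circle_compact: "compact (range (mode_sum 0 \<beta> A 0))"
proof -
  have "mode_sum 0 \<beta> A 0 = (\<lambda>z. z * Complex 0 A) \<circ> cis"
    by (simp add: fun_eq_iff mode_sum_def)
  moreover have "range cis = sphere 0 1"
  proof
    show "sphere 0 1 \<subseteq> range cis"
    proof
      fix z :: complex
      assume "z \<in> sphere 0 1"
      then have "cis (Arg z) = z"
        by (simp add: complex_norm_eq_1_exp_eq cis_conv_exp)
      then show "z \<in> range cis" by (metis rangeI)
    qed
  qed auto
  ultimately have "range (mode_sum 0 \<beta> A 0) = (\<lambda>z. z * Complex 0 A) ` sphere 0 1"
    by (metis image_comp)
  then show ?thesis
    by (auto intro!: compact_continuous_image continuous_intros)
qed

lemma growing_mode_short_past:
  assumes "\<alpha> > 0"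
  shows "\<not> complete_solution (\<alpha> + \<beta>) (1 - \<alpha> * \<beta>) (mode_sum \<alpha> \<beta> A 0)"
proof -
  have "(\<integral>\<^sup>+t\<in>{..0}. ennreal \<bar>rho (\<alpha> + \<beta>) (1 - \<alpha> * \<beta>) (mode_sum \<alpha> \<beta> A 0) t\<bar> \<partial>lborel)
     = (\<integral>\<^sup>+t\<in>{0..}. ennreal ((\<bar>A\<bar> * (\<alpha>\<^sup>2 + 1)) * exp (- \<alpha> * t)) \<partial>lborel)"
    by (subst nn_integral_atMost_reflect [OF rho_mode_sum_measurable])
       (simp add: rho_mode_sum abs_mult)
  also have "\<dots> < \<infinity>"
    using assms by (intro nn_integral_exp_decay_finite) auto
  finally show ?thesis unfolding complete_solution_def by (metis less_irrefl)
qed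

lemma decaying_mode_short_future:
  assumes "\<beta> < 0"
  shows "\<not> complete_solution (\<alpha> + \<beta>) (1 - \<alpha> * \<beta>) (mode_sum \<alpha> \<beta> 0 B)"
proof -
  have "(\<integral>\<^sup>+t\<in>{0..}. ennreal \<bar>rho (\<alpha> + \<beta>) (1 - \<alpha> * \<beta>) (mode_sum \<alpha> \<beta> 0 B) t\<bar> \<partial>lborel)
     = (\<integral>\<^sup>+t\<in>{0..}. ennreal ((\<bar>B\<bar> * (\<beta>\<^sup>2 + 1)) * exp (\<beta> * t)) \<partial>lborel)"
    by (simp add: rho_mode_sum abs_mult)
  also have "\<dots> < \<infinity>"
    using assms by (intro nn_integral_exp_decay_finite) auto
  finally show ?thesis unfolding complete_solution_def by (metis less_irrefl)
qed

section \<open>Classification\<close>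

lemma nonsingular_solution_cases:
  assumes "self_similar_solution (\<alpha> + \<beta>) (1 - \<alpha> * \<beta>) y"
    and "without_singularity (\<alpha> + \<beta>) (1 - \<alpha> * \<beta>) y" "\<alpha> \<noteq> \<beta>"
  obtains (both) "same_up_to_rotation_scaling (mode_sum \<alpha> \<beta> 1 1) y"
  | (first) A where "A \<noteq> 0" "y = mode_sum \<alpha> \<beta> A 0"
  | (second) B where "B \<noteq> 0" "y = mode_sum \<alpha> \<beta> 0 B"
proof -
  obtain A B where AB: "A \<noteq> 0 \<or> B \<noteq> 0" and y: "y = mode_sum \<alpha> \<beta> A B"
    using self_similar_is_mode_sum assms by metis
  have "A * B \<ge> 0"
    using nonsingular_mode_sum_same_sign assms y by blast
  then consider "A * B > 0" | "A \<noteq> 0" "B = 0" | "B \<noteq> 0" "A = 0"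
    using AB by (metis less_eq_real_def mult_eq_0_iff)
  then show ?thesis
    using mode_sum_same_up_to [OF _ assms(3)] both first second y by cases auto
qed

theorem corollary1p5:
  fixes c d K \<alpha> \<beta> :: real and x_plus :: "real \<Rightarrow> complex"
  assumes "d \<ge> 1" and "(c, d) \<noteq> (0, 1)"
    and "K = sqrt (c\<^sup>2 / 4 + d - 1)"
    and "\<alpha> = c / 2 + K" and "\<beta> = c / 2 - K"
    and "x_plus = (\<lambda>\<theta>.
           exp ((complex_of_real \<alpha> + \<i>) * complex_of_real \<theta>) * (\<i> - complex_of_real \<alpha>) +
           exp ((complex_of_real \<beta> + \<i>) * complex_of_real \<theta>) * (\<i> - complex_of_real \<beta>))"
  shows "(self_similar_solution c d x_plus \<and> without_singularity c d x_plus \<and>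
            \<not> logarithmic_spiral x_plus \<and>
            (\<forall>y. self_similar_solution c d y \<and> without_singularity c d y \<and>
                 \<not> logarithmic_spiral y \<longrightarrow> same_up_to_rotation_scaling x_plus y)) \<and>
         (complete_solution c d x_plus \<and> noncompact_curve x_plus \<and>
            (\<forall>y. self_similar_solution c d y \<and> complete_solution c d y \<and>
                 noncompact_curve y \<and> without_singularity c d y
               \<longrightarrow> same_up_to_rotation_scaling x_plus y))"
proof -
  have "c\<^sup>2 / 4 + d - 1 > 0"
  proof (cases "d = 1")
    case True
    then show ?thesis using assms(2) by simp
  next
    case False
    then have "d - 1 > 0" using assms(1) by simp
    then show ?thesis using zero_le_power2 [of c] by linarith
  qed
  then have K: "K > 0" "K\<^sup>2 = c\<^sup>2 / 4 + d - 1"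
    using assms(3) by simp_all
  have "\<bar>c / 2\<bar> \<le> K"
    using K assms(1) by (intro abs_le_square_iff [THEN iffD2, of "c / 2" K, simplified abs_of_pos [OF K(1)]])
      (simp add: power_divide)
  \<comment> \<open>The bound \<open>d \<ge> 1\<close> makes the product \<open>1 - d\<close> of the roots nonpositive; excluding \<open>(0, 1)\<close>
    excludes the double root \<open>0\<close>.\<close>
  then have signs: "\<beta> \<le> 0" "0 \<le> \<alpha>" and ne: "\<alpha> \<noteq> \<beta>"
    using K(1) assms(4,5) by auto
  have "\<alpha> * \<beta> = c\<^sup>2 / 4 - K\<^sup>2"
    unfolding assms(4,5) by (simp add: algebra_simps power2_eq_square)
  then have cd: "c = \<alpha> + \<beta>" "d = 1 - \<alpha> * \<beta>"
    using K(2) assms(4,5) by simp_all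
  have x: "x_plus = mode_sum \<alpha> \<beta> 1 1"
    unfolding assms(6) by (simp add: fun_eq_iff mode_sum_exp)
  have "self_similar_solution c d x_plus"
    unfolding cd x using ne by (simp add: self_similar_mode_sum)
  moreover have "without_singularity c d x_plus"
    unfolding cd x by (rule balanced_mode_sum_nonsingular)
  moreover have "\<not> logarithmic_spiral x_plus"
    unfolding x using ne by (rule balanced_mode_sum_not_spiral)
  moreover have "same_up_to_rotation_scaling x_plus y"
    if "self_similar_solution c d y" "without_singularity c d y" "\<not> logarithmic_spiral y" for y
    using that(1,2)[unfolded cd] ne
  proof (cases rule: nonsingular_solution_cases)
    case both
    then show ?thesis unfolding x .
  next
    case (first A)
    then show ?thesis using that(3) single_mode_logarithmic_spiral by blast
  next
    case (second B)
    then show ?thesis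
      using that(3) single_mode_logarithmic_spiral mode_sum_commute by metis
  qed
  moreover have "complete_solution c d x_plus"
    unfolding cd x using signs by (rule balanced_mode_sum_complete)
  moreover have "noncompact_curve x_plus"
    unfolding x using ne by (rule balanced_mode_sum_noncompact)
  moreover have "same_up_to_rotation_scaling x_plus y"
    if "self_similar_solution c d y" "without_singularity c d y"
      "complete_solution c d y" "noncompact_curve y" for y
    using that(1,2)[unfolded cd] ne
  proof (cases rule: nonsingular_solution_cases)
    case both
    then show ?thesis unfolding x .
  next
    case (first A)
    then have "\<alpha> = 0"
      using growing_mode_short_past that(3) signs unfolding cd by (metis less_eq_real_def)
    then show ?thesis
      using circle_compact first that(4) unfolding noncompact_curve_def by metis
  next
    case (second B)
    then have "\<beta> = 0"
      using decaying_mode_short_future that(3) signs unfolding cd by (metis less_eq_real_def)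
    then show ?thesis
      using circle_compact second that(4) mode_sum_commute unfolding noncompact_curve_def by metis
  qed
  ultimately show ?thesis by blast
qed

end
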